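(* Let $q$ be a prime power and $n$ a positive integer with $\gcd(n,q)=1$, and let $\alpha$ be a primitive $n$-th root of unity over $\mathbb{F}_q$. Let $\{i_1,\ldots,i_t\}$ be the set of all leaders of $q$-cyclotomic cosets modulo $n$, and $T=\{\alpha^{i_j}: 1\le j\le t\}$. Let $C$ and $D$ be cyclic codes of length $n$ over $\mathbb{F}_q$, and let $T_1\subseteq T$ be the set $T_1=\mathrm{BZ}(C^\perp)\cap\mathrm{BZ}(D^\perp)$. Then $$\dim(C\cap D)=\sum_{\alpha^{i_j}\in T_1}|B_{i_j}|.$$
   Context: A linear code of length $n$ over $\mathbb{F}_q$ is a subspace of $\mathbb{F}_q^n$; $C^\perp$ denotes its dual under the Euclidean inner product. A linear code is cyclic if it is closed under cyclic shifts; identifying $(c_0,\ldots,c_{n-1})$ with $\sum c_ix^i$, a cyclic code is an ideal of $\mathbb{F}_q[x]/(x^n-1)$, and its generator polynomial is the unique monic divisor $g(x)$ of $x^n-1$ generating it (for the zero code, $g(x)=x^n-1$). The dual of a cyclic code is cyclic. The $q$-cyclotomic coset of an integer $a$ modulo $n$ is $B_a=\{a,aq,\ldots,aq^{\delta_a-1}\}\subseteq\mathbb{Z}_n$ (reduced mod $n$), where $\delta_a=|B_a|$ is the smallest positive integer with $aq^{\delta_a}\equiv a \pmod n$. These cosets partition $\mathbb{Z}_n$; a set of coset leaders contains exactly one representative of each coset. For an integer $i$, $m_{\alpha^i}(x)=\prod_{s\in B_i}(x-\alpha^s)$ is the minimal polynomial of $\alpha^i$ over $\mathbb{F}_q$.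 If $E$ is a cyclic code of length $n$ whose generator polynomial is $\prod_{j\in S}m_{\alpha^{i_j}}(x)$ with $S\subseteq\{1,\ldots,t\}$, then $\mathrm{BZ}(E)=\{\alpha^{i_j}: j\in S\}$; thus $\mathrm{BZ}(C^\perp)$ (the basic dual zero of $C$) is computed from the generator polynomial of $C^\perp$, and likewise $\mathrm{BZ}(D^\perp)$. *)

theory Defs
  imports "Jordan_Normal_Form.VS_Connect" "HOL-Library.Cardinality"
begin

definition linear_code :: "nat \<Rightarrow> 'a::field vec set \<Rightarrow> bool" where
  "linear_code n C \<longleftrightarrow> VectorSpace.subspace class_ring C (module_vec TYPE('a) n)"

definition code_dim :: "nat \<Rightarrow> 'a::field vec set \<Rightarrow> nat" where
  "code_dim n C = vectorspace.dim class_ring ((module_vec TYPE('a) n)\<lparr>carrier := C\<rparr>)"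

definition dual_code :: "nat \<Rightarrow> 'a::field vec set \<Rightarrow> 'a vec set" where
  "dual_code n C = {v \<in> carrier_vec n. \<forall>c\<in>C. v \<bullet> c = 0}"

definition cyclic_shift :: "nat \<Rightarrow> 'a vec \<Rightarrow> 'a vec" where
  "cyclic_shift n c = vec n (\<lambda>i. c $ ((i + n - 1) mod n))"

definition cyclic_code :: "nat \<Rightarrow> 'a::field vec set \<Rightarrow> bool" where
  "cyclic_code n C \<longleftrightarrow> linear_code n C \<and> (\<forall>c\<in>C. cyclic_shift n c \<in> C)"

definition code_poly :: "'a::zero vec \<Rightarrow> 'a poly" where
  "code_poly c = Poly (list_of_vec c)"

text \<open>Elements of the quotient ring of polynomials modulo \<open>x^n - 1\<close> are represented by their
  remainders, so the range below is the ideal of the quotient ring generated by \<open>g\<close>.\<close>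

definition generates_code :: "nat \<Rightarrow> 'a::field vec set \<Rightarrow> 'a poly \<Rightarrow> bool" where
  "generates_code n C g \<longleftrightarrow>
     lead_coeff g = 1 \<and> g dvd (monom 1 n - 1) \<and>
     code_poly ` C = range (\<lambda>f. (f * g) mod (monom 1 n - 1))"

definition generator_poly :: "nat \<Rightarrow> 'a::field vec set \<Rightarrow> 'a poly" where
  "generator_poly n C = (THE g. generates_code n C g)"

definition primitive_root_of_unity :: "nat \<Rightarrow> 'b::field \<Rightarrow> bool" where
  "primitive_root_of_unity n \<alpha> \<longleftrightarrow> \<alpha> ^ n = 1 \<and> (\<forall>k. 0 < k \<and> k < n \<longrightarrow> \<alpha> ^ k \<noteq> 1)"

text \<open>Residue classes modulo \<open>n\<close> are represented by the integers in \<open>{0..<n}\<close>.\<close>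

definition coset_size :: "nat \<Rightarrow> nat \<Rightarrow> int \<Rightarrow> nat" where
  "coset_size q n a = (LEAST d. 0 < d \<and> (a * int q ^ d) mod int n = a mod int n)"

definition cyclotomic_coset :: "nat \<Rightarrow> nat \<Rightarrow> int \<Rightarrow> int set" where
  "cyclotomic_coset q n a = (\<lambda>k. (a * int q ^ k) mod int n) ` {..<coset_size q n a}"

text \<open>The leaders are \<open>i 1, \<dots>, i t\<close>: every coset is represented by exactly one of them.\<close>

definition coset_leaders :: "nat \<Rightarrow> nat \<Rightarrow> nat \<Rightarrow> (nat \<Rightarrow> int) \<Rightarrow> bool" where
  "coset_leaders q n t i \<longleftrightarrow>
     (\<forall>a. \<exists>!j. j \<in> {1..t} \<and> i j mod int n \<in> cyclotomic_coset q n a)"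

definition coset_min_poly :: "nat \<Rightarrow> nat \<Rightarrow> 'b::field \<Rightarrow> int \<Rightarrow> 'b poly" where
  "coset_min_poly q n \<alpha> a = (\<Prod>s\<in>cyclotomic_coset q n a. [:- (\<alpha> powi s), 1:])"

text \<open>Here \<open>h\<close> embeds the finite base field into an extension field containing \<open>\<alpha>\<close>, where the
  generator polynomial is factored. For a cyclic code of length \<open>n\<close>
  coprime to the field size, the index set \<open>S\<close> exists and is unique.\<close>

definition BZ ::
  "('a::{field,finite} \<Rightarrow> 'b::field) \<Rightarrow> nat \<Rightarrow> 'b \<Rightarrow> nat \<Rightarrow> (nat \<Rightarrow> int) \<Rightarrow> 'a vec set \<Rightarrow> 'b set" where
  "BZ h n \<alpha> t i E =
     (\<lambda>j. \<alpha> powi i j) `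
       (THE S. S \<subseteq> {1..t} \<and>
          map_poly h (generator_poly n E) = (\<Prod>j\<in>S. coset_min_poly CARD('a) n \<alpha> (i j)))"

end

theory Submission
  imports Defs "Jordan_Normal_Form.Char_Poly" "HOL-Number_Theory.Cong"
begin

text \<open>Write \<open>M = x^n - 1\<close>, and let \<open>g\<^sub>1\<close>, \<open>g\<^sub>2\<close> generate the duals of \<open>C\<close> and \<open>D\<close>. By double duality a
  word lies in \<open>C\<close> iff \<open>M\<close> divides \<open>g\<^sub>1\<close> times its reversed polynomial, so a word lies in
  \<open>C \<inter> D\<close> iff \<open>M\<close> divides \<open>G = gcd g\<^sub>1 g\<^sub>2\<close> times that polynomial. There are \<open>q\<close> to the \<open>degree G\<close>
  such words, hence \<open>degree G\<close> is the dimension. Since \<open>M\<close> splits into distinct linear factors over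
  the extension field, \<open>degree G\<close> is the number of common roots of \<open>g\<^sub>1\<close> and \<open>g\<^sub>2\<close>, and by
  the Frobenius map these roots form full cyclotomic cosets.\<close>

section \<open>Polynomials over a field\<close>

text \<open>A nonzero element of least degree, scaled to be monic, divides every member: a nonzero
  remainder would lie in the ideal and have smaller degree.\<close>

lemma poly_ideal_principal:
  fixes I :: "'a::field poly set"
  assumes zero: "0 \<in> I"
    and add: "\<And>p r. p \<in> I \<Longrightarrow> r \<in> I \<Longrightarrow> p + r \<in> I"
    and mult: "\<And>f p. p \<in> I \<Longrightarrow> f * p \<in> I"
    and nontriv: "m \<in> I" "m \<noteq> 0"
  obtains g where "I = {f. g dvd f}" "lead_coeff g = 1"
proof -
  obtain b where b: "b \<in> I" "b \<noteq> 0"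
    and least: "\<And>p. p \<in> I \<Longrightarrow> p \<noteq> 0 \<Longrightarrow> degree b \<le> degree p"
    using ex_has_least_nat[of "\<lambda>p. p \<in> I \<and> p \<noteq> 0" m degree] nontriv by auto
  define g where "g = Polynomial.smult (inverse (lead_coeff b)) b"
  have g: "g \<in> I"
    using mult[OF b(1), of "[:inverse (lead_coeff b):]"] by (simp add: g_def)
  have lc: "lead_coeff g = 1" using b(2) by (simp add: g_def)
  have deg: "degree g = degree b" using b(2) by (simp add: g_def)
  have "g dvd f" if f: "f \<in> I" for f
  proof (rule ccontr)
    assume n: "\<not> g dvd f"
    have "f mod g = f + (- (f div g)) * g"
      by (simp add: minus_div_mult_eq_mod[symmetric])
    hence "f mod g \<in> I" using add[OF f mult[OF g]] by metis
    moreover have "f mod g \<noteq> 0" using n by (simp add: mod_eq_0_iff_dvd)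
    ultimately have "degree g \<le> degree (f mod g)" using least deg by metis
    moreover have "degree (f mod g) < degree g"
      using degree_mod_less[of g f] \<open>f mod g \<noteq> 0\<close> lc by force
    ultimately show False by simp
  qed
  moreover have "f \<in> I" if "g dvd f" for f
    using that mult[OF g] by (auto simp: dvd_def mult.commute)
  ultimately have "I = {f. g dvd f}" by blast
  with lc that show ?thesis by blast
qed

text \<open>The combinations of \<open>p\<close> and \<open>r\<close> form an ideal, and its monic
  generator is a gcd. The explicit coefficients serve twice later: to pass divisibility by x^n - 1
  from both generators to their gcd, and to pass common roots to it.\<close>

lemma monic_poly_bezout:
  fixes p r :: "'a::field poly"
  assumes "p \<noteq> 0"
  obtains g u v where "lead_coeff g = 1" "g = u * p + v * r" "g dvd p" "g dvd r"
proof -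
  define I where "I = {u * p + v * r | u v. True}"
  have I: "u * p + v * r \<in> I" for u v unfolding I_def by blast
  obtain g where g: "I = {f. g dvd f}" "lead_coeff g = 1"
  proof (rule poly_ideal_principal[of I p])
    show "0 \<in> I" using I[of 0 0] by simp
    show "p \<in> I" using I[of 1 0] by simp
    fix a b f assume "a \<in> I"
    then obtain u v where a: "a = u * p + v * r" unfolding I_def by blast
    show "f * a \<in> I" using I[of "f * u" "f * v"] by (simp add: a algebra_simps)
    assume "b \<in> I"
    then obtain u' v' where b: "b = u' * p + v' * r" unfolding I_def by blast
    show "a + b \<in> I" using I[of "u + u'" "v + v'"] by (simp add: a b algebra_simps)
  qed (use assms in auto)
  have "g \<in> I" using g(1) by simp
  then obtain u v where "g = u * p + v * r" unfolding I_def by blast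
  moreover have "g dvd p" "g dvd r" using g(1) I[of 1 0] I[of 0 1] by auto
  ultimately show ?thesis using that g(2) by blast
qed

lemma monic_dvd_antisym:
  fixes p r :: "'a::field poly"
  assumes "p dvd r" "r dvd p" "lead_coeff p = 1" "lead_coeff r = 1"
  shows "p = r"
proof -
  from assms(1) obtain c where c: "r = p * c" ..
  have "p \<noteq> 0" "r \<noteq> 0" using assms(3,4) by auto
  hence "degree c = 0"
    using c assms(1,2) by (metis add_cancel_left_right degree_mult_eq dvd_imp_degree_le
        le_antisym mult_zero_right)
  then obtain a where "c = [:a:]" by (metis degree_eq_zeroE)
  moreover have "lead_coeff c = 1" using c assms(3,4) by (simp add: lead_coeff_mult)
  ultimately show ?thesis using c by simp
qed

lemma lead_coeff_prod_linear: "lead_coeff (\<Prod>a\<in>A. [:- a, 1:] :: 'b::field poly) = 1"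
  by (simp add: lead_coeff_prod)

text \<open>Induction on \<open>A\<close>: each linear factor x - a divides \<open>P * Q\<close>, so
  it can be cancelled from \<open>P\<close> if \<open>P\<close> vanishes at a, and from
  \<open>Q\<close> otherwise. The roots being distinct, cancelling from \<open>P\<close> leaves its
  zeros in the remaining set unchanged.\<close>

lemma monic_dvd_prod_linear:
  fixes P Q :: "'b::field poly"
  assumes "finite A" "P * Q = (\<Prod>a\<in>A. [:- a, 1:])" "lead_coeff P = 1"
  shows "P = (\<Prod>a\<in>{a \<in> A. poly P a = 0}. [:- a, 1:])"
  using assms
proof (induction A arbitrary: P Q rule: finite_induct)
  case empty
  hence "P dvd 1" by (metis dvd_triv_left prod.empty)
  moreover have "1 dvd P" by simp
  ultimately show ?case using monic_dvd_antisym[of P 1] empty by simp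
next
  case (insert a A)
  define N where "N = (\<Prod>a\<in>A. [:- a, 1:])"
  have PQ: "P * Q = [:- a, 1:] * N" using insert by (simp add: N_def)
  have Na: "poly N a \<noteq> 0" using insert by (auto simp: N_def poly_prod)
  show ?case
  proof (cases "poly P a = 0")
    case True
    then obtain P' where P': "P = [:- a, 1:] * P'" by (auto simp: poly_eq_0_iff_dvd)
    have "[:- a, 1:] * (P' * Q) = [:- a, 1:] * N" using PQ P' by (simp only: mult.assoc)
    hence N: "P' * Q = N" by (subst (asm) mult_cancel_left) auto
    have "lead_coeff P' = 1" using insert.prems(2) by (simp add: P' lead_coeff_mult del: mult_pCons_left)
    with insert.IH[of P' Q] N have IH: "P' = (\<Prod>a\<in>{a \<in> A. poly P' a = 0}. [:- a, 1:])"
      by (simp add: N_def)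
    have "{b \<in> insert a A. poly P b = 0} = insert a {a \<in> A. poly P' a = 0}"
      using insert.hyps(2) by (auto simp: P')
    hence "(\<Prod>b\<in>{b \<in> insert a A. poly P b = 0}. [:- b, 1:]) = [:- a, 1:] * P'"
      using insert.hyps by (subst IH) (simp del: mult_pCons_left)
    thus ?thesis by (simp only: P')
  next
    case False
    have "poly (P * Q) a = 0" by (simp add: PQ)
    with False have "poly Q a = 0" by simp
    then obtain Q' where Q': "Q = [:- a, 1:] * Q'" by (auto simp: poly_eq_0_iff_dvd)
    have "[:- a, 1:] * (P * Q') = [:- a, 1:] * N" using PQ Q' by (simp only: mult_ac)
    hence N: "P * Q' = N" by (subst (asm) mult_cancel_left) auto
    with insert.IH[of P Q'] insert.prems have "P = (\<Prod>a\<in>{a \<in> A. poly P a = 0}. [:- a, 1:])"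
      by (simp add: N_def)
    moreover have "{b \<in> insert a A. poly P b = 0} = {a \<in> A. poly P a = 0}" using False by auto
    ultimately show ?thesis by simp
  qed
qed

text \<open>Bounding coefficients instead of the degree makes the bound 0 meaningful: it leaves
  exactly the zero polynomial, whereas no degree is below 0. The count q^n then holds from n = 0
  on.\<close>

definition polys_below :: "nat \<Rightarrow> 'a::zero poly set" where
  "polys_below n = {p. \<forall>i\<ge>n. coeff p i = 0}"

lemma polys_below_iff: "0 < n \<Longrightarrow> p \<in> polys_below n \<longleftrightarrow> degree p < n"
  unfolding polys_below_def
  by (auto simp: coeff_eq_0 intro: le_less_trans[OF degree_le[of "n - 1"]])

lemma card_polys_below: "card (polys_below n :: 'a::{zero,finite} poly set) = CARD('a) ^ n"
proof (induction n)
  case 0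
  have "polys_below 0 = {0 :: 'a poly}" by (auto simp: polys_below_def poly_eq_iff)
  thus ?case by simp
next
  case (Suc n)
  have "polys_below (Suc n) = (\<lambda>(a, p). pCons a p) ` ((UNIV :: 'a set) \<times> polys_below n)"
  proof (intro equalityI subsetI)
    fix p :: "'a poly" assume p: "p \<in> polys_below (Suc n)"
    obtain a r where ar: "p = pCons a r" by (cases p)
    have "r \<in> polys_below n" using p
      by (auto simp: ar polys_below_def coeff_pCons split: nat.splits)
    thus "p \<in> (\<lambda>(a, p). pCons a p) ` (UNIV \<times> polys_below n)" by (auto simp: ar)
  qed (auto simp: polys_below_def coeff_pCons split: nat.splits)
  moreover have "inj_on (\<lambda>(a, p). pCons a p) ((UNIV :: 'a set) \<times> polys_below n)"
    by (auto simp: inj_on_def)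
  ultimately show ?case by (simp add: card_image card_cartesian_product Suc.IH)
qed

text \<open>Multiplication by \<open>L\<close> is injective and raises the degree by
  \<open>degree L\<close>, so the cofactors range over all polynomials below the bound
  \<open>k\<close>.\<close>

lemma card_multiples_polys_below:
  fixes L :: "'a::{field,finite} poly"
  assumes "L \<noteq> 0"
  shows "card {p \<in> polys_below (degree L + k). L dvd p} = CARD('a) ^ k"
proof -
  have "{p \<in> polys_below (degree L + k). L dvd p} = (\<lambda>p. L * p) ` polys_below k"
  proof (intro equalityI subsetI)
    fix p assume "p \<in> {p \<in> polys_below (degree L + k). L dvd p}"
    then obtain r where p: "p = L * r" and b: "L * r \<in> polys_below (degree L + k)" by (auto simp: dvd_def)
    have "r \<in> polys_below k"
    \<comment> \<open>Degrees add only for nonzero factors, and the bound is a statement about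
      degrees only when it is positive.\<close>
    proof (cases "r = 0 \<or> k = 0")
      case True
      have "r = 0" if "k = 0"
      proof (rule ccontr)
        assume "r \<noteq> 0"
        hence "coeff (L * r) (degree L + degree r) \<noteq> 0"
          using assms by (simp add: coeff_mult_degree_sum)
        thus False using b that by (simp add: polys_below_def)
      qed
      thus ?thesis using True by (auto simp: polys_below_def)
    next
      case False
      thus ?thesis using b assms by (simp add: polys_below_iff degree_mult_eq)
    qed
    thus "p \<in> (\<lambda>p. L * p) ` polys_below k" using p by blast
  next
    fix p assume "p \<in> (\<lambda>p. L * p) ` polys_below k"
    then obtain r where p: "p = L * r" and r: "r \<in> polys_below k" by auto
    have "L * r \<in> polys_below (degree L + k)"
    proof (cases "r = 0 \<or> k = 0")
      case True
      hence "r = 0" using r by (auto simp: polys_below_def poly_eq_iff)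
      thus ?thesis by (simp add: polys_below_def)
    next
      case False
      thus ?thesis using r assms by (simp add: polys_below_iff degree_mult_eq)
    qed
    thus "p \<in> {p \<in> polys_below (degree L + k). L dvd p}" by (simp add: p)
  qed
  moreover have "inj_on (\<lambda>p. L * p) (polys_below k)" using assms by (auto simp: inj_on_def)
  ultimately show ?thesis by (simp add: card_image card_polys_below)
qed

section \<open>Arithmetic modulo \<open>x\<^sup>n - 1\<close>\<close>

lemma
  assumes "0 < n"
  shows degree_xn_1: "degree (monom 1 n - 1 :: 'a::field poly) = n"
    and lead_coeff_xn_1: "lead_coeff (monom 1 n - 1 :: 'a::field poly) = 1"
    and xn_1_nonzero: "(monom 1 n - 1 :: 'a::field poly) \<noteq> 0"
proof -
  have "monom 1 n - 1 = monom 1 n + (- 1 :: 'a poly)" by simp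
  moreover have "degree (- 1 :: 'a poly) < degree (monom (1::'a) n)"
    using assms by (simp add: degree_monom_eq)
  ultimately show d: "degree (monom 1 n - 1 :: 'a::field poly) = n"
    by (metis degree_add_eq_left degree_monom_eq one_neq_zero)
  show "lead_coeff (monom 1 n - 1 :: 'a::field poly) = 1" using assms by (simp add: d)
  thus "(monom 1 n - 1 :: 'a::field poly) \<noteq> 0" by (metis leading_coeff_0_iff zero_neq_one)
qed

lemma degree_mod_xn_1:
  "0 < n \<Longrightarrow> degree ((f :: 'a::field poly) mod (monom 1 n - 1)) < n"
  using degree_mod_less[of "monom 1 n - 1" f] degree_xn_1[of n, where ?'a='a]
    xn_1_nonzero[of n, where ?'a='a] by auto

lemma mod_xn_1_small:
  "degree (f :: 'a::field poly) < n \<Longrightarrow> f mod (monom 1 n - 1) = f"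
  using degree_xn_1[of n, where ?'a='a] by (intro mod_poly_less) auto

text \<open>The pairing \<open>(u, w) \<mapsto> coefficient of x\<^sup>n\<^sup>-\<^sup>1 in u w mod (x\<^sup>n - 1)\<close> is nondegenerate and, up to
  reversing \<open>u\<close>, is the Euclidean inner product; this turns orthogonality into divisibility.\<close>

lemma coeff_mod_xn_1:
  fixes f :: "'a::field poly"
  assumes n: "0 < n" and f: "degree f < 2 * n - 1"
  shows "coeff (f mod (monom 1 n - 1)) (n - 1) = coeff f (n - 1)"
proof -
  \<comment> \<open>The quotient has degree at most deg f - n, which is below n - 1. In f = x^n Q -
    Q + r the first term starts at x^n, and \<open>Q\<close> has no coefficient at n - 1, so only
    the remainder contributes there.\<close>
  define Q where "Q = f div (monom 1 n - 1)"
  have Q: "coeff Q (n - 1) = 0"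
  proof (cases "Q = 0")
    case False
    have "degree Q + n = degree f"
    proof -
      have "degree f \<ge> n"
        using False degree_xn_1[OF n, where ?'a='a] unfolding Q_def
        by (metis div_poly_less not_le)
      have "degree (Q * (monom 1 n - 1)) = degree Q + n"
        using False by (subst degree_mult_eq[OF _ xn_1_nonzero[OF n]]) (simp_all add: degree_xn_1[OF n])
      moreover have "f = Q * (monom 1 n - 1) + f mod (monom 1 n - 1)"
        unfolding Q_def by (rule div_mult_mod_eq[symmetric])
      moreover have "degree (f mod (monom 1 n - 1)) < degree Q + n"
        using degree_mod_xn_1[OF n, of f] by simp
      ultimately show ?thesis by (metis degree_add_eq_left)
    qed
    thus ?thesis using f by (intro coeff_eq_0) linarith
  qed simp
  have "f = (monom 1 n - 1) * Q + f mod (monom 1 n - 1)" unfolding Q_def by (rule mult_div_mod_eq[symmetric])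
  also have "(monom 1 n - 1) * Q = monom 1 n * Q - Q" by (simp add: left_diff_distrib)
  finally have "f = monom 1 n * Q - Q + f mod (monom 1 n - 1)" .
  hence "coeff f (n - 1) = coeff (monom 1 n * Q - Q + f mod (monom 1 n - 1)) (n - 1)" by metis
  thus ?thesis using n Q by (simp add: coeff_monom_mult)
qed

lemma xn_1_dvd_if_coeffs:
  fixes f :: "'a::field poly"
  assumes n: "0 < n"
    and z: "\<And>k. coeff ((monom 1 k * f) mod (monom 1 n - 1)) (n - 1) = 0"
  shows "monom 1 n - 1 dvd f"
proof (rule ccontr)
  define r where "r = f mod (monom 1 n - 1)"
  assume "\<not> monom 1 n - 1 dvd f"
  hence r: "r \<noteq> 0" by (simp add: r_def mod_eq_0_iff_dvd)
  \<comment> \<open>This shift moves the leading coefficient of the remainder to position n - 1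
    without any wrap-around.\<close>
  define k where "k = n - 1 - degree r"
  have d: "degree r < n" unfolding r_def by (rule degree_mod_xn_1[OF n])
  have "degree (monom 1 k * r) < n"
    using r d by (simp add: degree_mult_eq degree_monom_eq k_def)
  hence "(monom 1 k * f) mod (monom 1 n - 1) = monom 1 k * r"
    by (metis mod_mult_right_eq mod_xn_1_small r_def)
  moreover have "coeff (monom 1 k * r) (n - 1) = lead_coeff r"
    using d by (simp add: coeff_monom_mult k_def)
  ultimately show False using z[of k] r by simp
qed

text \<open>The variable is a unit modulo x^n - 1, with inverse x^(n-1).\<close>

lemma xn_1_dvd_cancel_x:
  fixes f :: "'a::field poly"
  assumes n: "0 < n" and d: "monom 1 n - 1 dvd monom 1 1 * f"
  shows "monom 1 n - 1 dvd f"
proof -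
  have "monom (1::'a) n = monom 1 (n - 1) * monom 1 1" using n by (simp add: mult_monom)
  hence "monom 1 n * f = monom 1 (n - 1) * (monom 1 1 * f)" by (simp only: mult.assoc)
  hence "monom 1 n - 1 dvd monom 1 n * f" using d by (metis dvd_mult)
  moreover have "monom 1 n - 1 dvd monom 1 n * f - f"
    by (metis dvd_triv_left left_diff_distrib' mult_1)
  ultimately have "monom 1 n - 1 dvd monom 1 n * f - (monom 1 n * f - f)" by (rule dvd_diff)
  thus ?thesis by simp
qed

section \<open>Polynomials of codewords\<close>

lemma coeff_code_poly:
  "coeff (code_poly c) i = (if i < dim_vec c then c $ i else 0)"
  by (simp add: code_poly_def coeff_Poly_eq nth_default_def)

lemma code_poly_below: "c \<in> carrier_vec n \<Longrightarrow> code_poly c \<in> polys_below n"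
  by (auto simp: polys_below_def coeff_code_poly)

lemma degree_code_poly: "0 < n \<Longrightarrow> c \<in> carrier_vec n \<Longrightarrow> degree (code_poly c) < n"
  using code_poly_below[of c n] by (simp add: polys_below_iff)

lemma code_poly_inj: "inj_on code_poly (carrier_vec n)"
  by (intro inj_onI eq_vecI) (auto simp: poly_eq_iff coeff_code_poly split: if_splits)

lemma code_poly_image_carrier: "code_poly ` carrier_vec n = polys_below n"
proof (intro equalityI subsetI)
  fix p :: "'a poly" assume p: "p \<in> polys_below n"
  have "p = code_poly (vec n (coeff p))"
    using p by (auto simp: poly_eq_iff coeff_code_poly polys_below_def)
  thus "p \<in> code_poly ` carrier_vec n" by (rule image_eqI) simp
qed (auto simp: code_poly_below)

lemma code_poly_add:
  "u \<in> carrier_vec n \<Longrightarrow> v \<in> carrier_vec n \<Longrightarrow>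
    code_poly (u + v :: 'a::comm_monoid_add vec) = code_poly u + code_poly v"
  by (auto simp: poly_eq_iff coeff_code_poly)

lemma code_poly_smult: "code_poly (a \<cdot>\<^sub>v u) = Polynomial.smult (a :: 'a::comm_semiring_0) (code_poly u)"
  by (auto simp: poly_eq_iff coeff_code_poly)

lemma code_poly_zero: "code_poly (0\<^sub>v n) = 0"
  by (auto simp: poly_eq_iff coeff_code_poly)

lemma cyclic_shift_carrier: "cyclic_shift n c \<in> carrier_vec n"
  by (simp add: cyclic_shift_def)

lemma cyclic_shift_index:
  assumes "i < n"
  shows "cyclic_shift n c $ i = (if i = 0 then c $ (n - 1) else c $ (i - 1))"
proof (cases "i = 0")
  case False
  hence "i + n - 1 = (i - 1) + n" by simp
  hence "(i + n - 1) mod n = (i - 1) mod n" by (metis mod_add_self2)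
  thus ?thesis using False assms by (simp add: cyclic_shift_def)
qed (use assms in \<open>simp add: cyclic_shift_def\<close>)

text \<open>The coefficient pushed to x^n by multiplication with x re-enters as the constant term,
  which is a correction by a multiple of x^n - 1. The exact identity, not only the congruence, is
  used for closure of the dual under shifts.\<close>

lemma code_poly_shift:
  assumes n: "0 < n" and c: "c \<in> carrier_vec n"
  shows "monom 1 1 * code_poly c
    = code_poly (cyclic_shift n c) + Polynomial.smult (c $ (n - 1)) (monom 1 n - 1 :: 'a::field poly)"
proof (rule poly_eqI)
  fix i
  show "coeff (monom 1 1 * code_poly c) i =
      coeff (code_poly (cyclic_shift n c) + Polynomial.smult (c $ (n - 1)) (monom 1 n - 1)) i"
  proof (cases i)
    case 0
    thus ?thesis using n c cyclic_shift_carrier[of n c]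
      by (simp add: coeff_monom_mult coeff_code_poly cyclic_shift_index)
  next
    case (Suc k)
    consider "Suc k < n" | "n = Suc k" | "n < Suc k" by linarith
    thus ?thesis using n c cyclic_shift_carrier[of n c]
      by cases (simp_all add: Suc coeff_monom_mult coeff_code_poly cyclic_shift_index)
  qed
qed

lemma code_poly_shift_mod:
  assumes n: "0 < n" and c: "c \<in> carrier_vec n"
  shows "(monom 1 1 * code_poly c) mod (monom 1 n - 1 :: 'a::field poly)
    = code_poly (cyclic_shift n c)"
  unfolding code_poly_shift[OF assms] poly_mod_add_left mod_smult_left
  by (simp add: mod_xn_1_small degree_code_poly[OF n cyclic_shift_carrier])

section \<open>Reversed words and the inner product\<close>

definition rev_vec :: "'a vec \<Rightarrow> 'a vec" where
  "rev_vec v = vec (dim_vec v) (\<lambda>i. v $ (dim_vec v - 1 - i))"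

lemma dim_rev_vec: "dim_vec (rev_vec v) = dim_vec v"
  by (simp add: rev_vec_def)

lemma rev_vec_carrier: "v \<in> carrier_vec n \<Longrightarrow> rev_vec v \<in> carrier_vec n"
  by (metis carrier_vecD dim_rev_vec carrier_vecI)

lemma rev_vec_index: "v \<in> carrier_vec n \<Longrightarrow> i < n \<Longrightarrow> rev_vec v $ i = v $ (n - 1 - i)"
  by (auto simp: rev_vec_def)

lemma rev_vec_rev_vec: "rev_vec (rev_vec v) = v"
  by (intro eq_vecI) (auto simp: rev_vec_def)

lemma bij_betw_rev_vec: "bij_betw rev_vec (carrier_vec n) (carrier_vec n)"
  by (intro bij_betwI[where g = rev_vec]) (auto simp: rev_vec_carrier rev_vec_rev_vec)

text \<open>The product has degree at most 2n - 2, so reduction leaves its coefficient at n - 1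
  alone. That coefficient is a convolution, and the reversal aligns equal indices of
  \<open>v\<close> and \<open>c\<close>.\<close>

lemma scalar_prod_code_poly:
  assumes n: "0 < n" and v: "v \<in> carrier_vec n" and c: "c \<in> carrier_vec n"
  shows "coeff ((code_poly (rev_vec v) * code_poly c) mod (monom 1 n - 1)) (n - 1)
    = v \<bullet> (c :: 'a::field vec)"
proof -
  have "degree (code_poly (rev_vec v) * code_poly c) < 2 * n - 1"
    using degree_mult_le[of "code_poly (rev_vec v)" "code_poly c"]
      degree_code_poly[OF n rev_vec_carrier[OF v]] degree_code_poly[OF n c] by linarith
  hence "coeff ((code_poly (rev_vec v) * code_poly c) mod (monom 1 n - 1)) (n - 1)
    = (\<Sum>i\<le>n - 1. coeff (code_poly (rev_vec v)) i * coeff (code_poly c) (n - 1 - i))"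
    by (simp only: coeff_mod_xn_1[OF n] coeff_mult)
  also have "\<dots> = (\<Sum>i<n. v $ (n - 1 - i) * c $ (n - 1 - i))"
    using n v c rev_vec_carrier[OF v]
    by (intro sum.cong) (auto simp: coeff_code_poly rev_vec_def)
  also have "\<dots> = (\<Sum>i<n. v $ i * c $ i)"
    by (rule sum.reindex_bij_witness[of _ "\<lambda>i. n - 1 - i" "\<lambda>i. n - 1 - i"]) auto
  also have "\<dots> = v \<bullet> c" using c by (simp add: scalar_prod_def lessThan_atLeast0)
  finally show ?thesis .
qed

text \<open>Reversal conjugates the cyclic shift to its inverse.\<close>

lemma rev_vec_cyclic_shift:
  assumes n: "0 < n" and v: "v \<in> carrier_vec n"
  shows "cyclic_shift n (rev_vec (cyclic_shift n v)) = rev_vec v"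
proof (rule eq_vecI)
  fix i assume "i < dim_vec (rev_vec v)"
  hence i: "i < n" using v by (simp add: dim_rev_vec)
  show "cyclic_shift n (rev_vec (cyclic_shift n v)) $ i = rev_vec v $ i"
    using i v cyclic_shift_carrier[of n v]
    by (cases "i = 0") (simp_all add: cyclic_shift_index rev_vec_index[of _ n])
qed (use v in \<open>simp add: dim_rev_vec cyclic_shift_def\<close>)

section \<open>Cyclic codes and their duals\<close>

lemma linear_code_iff:
  "linear_code n (C :: 'a::field vec set) \<longleftrightarrow>
    C \<subseteq> carrier_vec n \<and> 0\<^sub>v n \<in> C \<and> (\<forall>u\<in>C. \<forall>v\<in>C. u + v \<in> C) \<and> (\<forall>a. \<forall>u\<in>C. a \<cdot>\<^sub>v u \<in> C)"
proof -
  interpret vec_space "TYPE('a)" n .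
  have "vectorspace class_ring (module_vec TYPE('a) n)" "Module.module class_ring (module_vec TYPE('a) n)"
    by unfold_locales
  thus ?thesis
    unfolding linear_code_def VectorSpace.subspace_def submodule_def
    by (auto simp: module_vec_simps class_ring_simps)
qed

lemma linear_code_Int: "linear_code n C \<Longrightarrow> linear_code n D \<Longrightarrow> linear_code n (C \<inter> D)"
  by (auto simp: linear_code_iff)

text \<open>Coordinates in a basis put the code in bijection with the functions from the basis to
  the field. This lets the dimension be read off from a count of codewords.\<close>

lemma card_eq_power_code_dim:
  fixes C :: "'a::{field,finite} vec set"
  assumes "linear_code n C" and finC: "finite C"
  shows "card C = CARD('a) ^ code_dim n C"
proof -
  interpret vec_space "TYPE('a)" n .
  have sub: "VectorSpace.subspace class_ring C (module_vec TYPE('a) n)"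
    using assms(1) by (simp add: linear_code_def)
  interpret W: vectorspace class_ring "(module_vec TYPE('a) n)\<lparr>carrier := C\<rparr>"
    by (rule subspace_is_vs[OF sub])
  \<comment> \<open>A finite code is its own finite generating set, which gives finite dimension and
    hence a basis.\<close>
  have "W.gen_set C"
    using W.in_own_span[of C] W.span_is_subset2[of C] by auto
  hence "W.fin_dim" unfolding W.fin_dim_def using finC by (intro exI[of _ C]) simp
  then obtain B where B: "finite B" "W.basis B" using W.finite_basis_exists by blast
  have BC: "B \<subseteq> C" using B(2) by (simp add: W.basis_def)
  have ex1: "\<forall>v\<in>C. \<exists>!a. a \<in> B \<rightarrow>\<^sub>E UNIV \<and> W.lincomb a B = v"
    using W.basis_criterion[OF B(1)] B(2) BC by (simp add: class_ring_simps)
  \<comment> \<open>Coordinate functions are taken extensional on \<open>B\<close>; values outside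
    \<open>B\<close> would spoil uniqueness.\<close>
  have "bij_betw (\<lambda>a. W.lincomb a B) (B \<rightarrow>\<^sub>E (UNIV :: 'a set)) C"
    unfolding bij_betw_def
  proof
    have mem: "W.lincomb a B \<in> C" for a
      using W.lincomb_closed[of B a] BC by (simp add: class_ring_simps)
    show "inj_on (\<lambda>a. W.lincomb a B) (B \<rightarrow>\<^sub>E UNIV)"
      using ex1 mem by (intro inj_onI) metis
    show "(\<lambda>a. W.lincomb a B) ` (B \<rightarrow>\<^sub>E UNIV) = C"
      using ex1 mem by (auto simp: image_iff)
  qed
  hence "card C = card (B \<rightarrow>\<^sub>E (UNIV :: 'a set))" by (simp add: bij_betw_same_card)
  also have "\<dots> = CARD('a) ^ card B" using B(1) by (simp add: card_PiE)
  also have "card B = code_dim n C" unfolding code_dim_def using W.dim_basis[OF B] by simp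
  finally show ?thesis .
qed

section \<open>Generator polynomials\<close>

lemma generates_code_mem_iff:
  assumes "0 < n" "generates_code n E g" "E \<subseteq> carrier_vec n" "c \<in> carrier_vec n"
  shows "c \<in> E \<longleftrightarrow> (g :: 'a::field poly) dvd code_poly c"
proof
  assume "c \<in> E"
  hence "code_poly c \<in> range (\<lambda>f. (f * g) mod (monom 1 n - 1))"
    using assms(2) unfolding generates_code_def by blast
  \<comment> \<open>Since \<open>g\<close> divides x^n - 1, reduction preserves divisibility by
    \<open>g\<close>.\<close>
  thus "g dvd code_poly c" using assms(2) by (auto simp: generates_code_def dvd_mod_iff)
next
  assume "g dvd code_poly c"
  then obtain f where "code_poly c = f * g" by (metis dvd_def mult.commute)
  hence "code_poly c = (f * g) mod (monom 1 n - 1)"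
    by (metis assms(1,4) degree_code_poly mod_xn_1_small)
  hence "code_poly c \<in> code_poly ` E" using assms(2) unfolding generates_code_def by blast
  thus "c \<in> E" using assms(3,4) code_poly_inj[of n] by (auto dest: inj_onD)
qed

lemma generates_code_unique:
  assumes "0 < n" "generates_code n E g" "generates_code n E g'"
  shows "g = (g' :: 'a::field poly)"
proof -
  have dvd: "g dvd g'" if "generates_code n E g" "generates_code n E g'" for g g' :: "'a poly"
  proof -
    have "(1 * g') mod (monom 1 n - 1) \<in> range (\<lambda>f. (f * g) mod (monom 1 n - 1))"
      using that unfolding generates_code_def by blast
    then obtain f where "g' mod (monom 1 n - 1) = (f * g) mod (monom 1 n - 1)" by auto
    moreover have "g dvd (f * g) mod (monom 1 n - 1)"
      using that(1) by (simp add: generates_code_def dvd_mod_iff)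
    ultimately show ?thesis using that(1) by (metis generates_code_def dvd_mod_iff)
  qed
  show ?thesis
    by (rule monic_dvd_antisym[OF dvd[OF assms(2,3)] dvd[OF assms(3,2)]])
      (use assms in \<open>simp_all add: generates_code_def\<close>)
qed

text \<open>The polynomials whose remainder is a codeword form an ideal containing x^n - 1, so a
  monic generator exists and divides x^n - 1. For the zero code this generator is x^n - 1
  itself.\<close>

lemma cyclic_code_ex_generator:
  fixes E :: "'a::field vec set"
  assumes n: "0 < n" and E: "cyclic_code n E"
  obtains g where "generates_code n E g"
proof -
  define M :: "'a poly" where "M = monom 1 n - 1"
  define I where "I = {f. f mod M \<in> code_poly ` E}"
  have lin: "E \<subseteq> carrier_vec n" "0\<^sub>v n \<in> E" "\<And>u v. u \<in> E \<Longrightarrow> v \<in> E \<Longrightarrow> u + v \<in> E"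
    "\<And>a u. u \<in> E \<Longrightarrow> a \<cdot>\<^sub>v u \<in> E"
    using E by (auto simp: cyclic_code_def linear_code_iff)
  have I_add: "p + r \<in> I" if pr: "p \<in> I" "r \<in> I" for p r
  proof -
    obtain u v where "u \<in> E" "v \<in> E" "p mod M = code_poly u" "r mod M = code_poly v"
      using pr unfolding I_def by blast
    moreover from this have "code_poly (u + v) = code_poly u + code_poly v"
      using lin(1) by (intro code_poly_add[of _ n]) auto
    ultimately have "(p + r) mod M = code_poly (u + v)" "u + v \<in> E"
      using lin(3) by (simp_all add: poly_mod_add_left)
    thus ?thesis unfolding I_def by blast
  qed
  have I_smult: "Polynomial.smult a p \<in> I" if p: "p \<in> I" for a p
  proof -
    obtain u where u: "u \<in> E" "p mod M = code_poly u" using p unfolding I_def by blast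
    hence "Polynomial.smult a p mod M = code_poly (a \<cdot>\<^sub>v u)"
      by (simp add: mod_smult_left code_poly_smult)
    thus ?thesis using lin(4)[OF u(1)] unfolding I_def by blast
  qed
  have I_shift: "monom 1 1 * p \<in> I" if p: "p \<in> I" for p
  proof -
    obtain u where u: "u \<in> E" "p mod M = code_poly u" using p unfolding I_def by blast
    have uc: "u \<in> carrier_vec n" using u(1) lin(1) by blast
    have "(monom 1 1 * p) mod M = (monom 1 1 * (p mod M)) mod M" by (rule mod_mult_right_eq[symmetric])
    also have "\<dots> = code_poly (cyclic_shift n u)"
      by (subst u(2)) (use code_poly_shift_mod[OF n uc] in \<open>simp only: M_def\<close>)
    finally have "(monom 1 1 * p) mod M = code_poly (cyclic_shift n u)" .
    moreover have "cyclic_shift n u \<in> E" using u(1) E by (simp add: cyclic_code_def)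
    ultimately show ?thesis unfolding I_def by blast
  qed
  have "0 mod M = code_poly (0\<^sub>v n)" by (simp add: code_poly_zero)
  hence zero: "0 \<in> I" using lin(2) unfolding I_def by blast
  \<comment> \<open>Horner-style induction on \<open>f\<close>: closure under scalars comes from
    linearity, and closure under x from the cyclic shift.\<close>
  have I_mult: "f * p \<in> I" if "p \<in> I" for f p
  proof (induction f)
    case 0
    show ?case using zero by simp
  next
    case (pCons a f)
    have "pCons a f * p = Polynomial.smult a p + monom 1 1 * (f * p)"
      by (simp add: monom_altdef)
    thus ?case using I_add I_smult I_shift that pCons by metis
  qed
  have "M mod M = code_poly (0\<^sub>v n)" by (simp add: code_poly_zero)
  hence MI: "M \<in> I" using lin(2) unfolding I_def by blast
  have "M \<noteq> 0" using xn_1_nonzero[OF n] by (simp add: M_def)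
  from poly_ideal_principal[OF zero I_add I_mult MI this]
  obtain g where g: "I = {f. g dvd f}" "lead_coeff g = 1" by metis
  have gM: "g dvd M" using MI g(1) by simp
  have "code_poly ` E = range (\<lambda>f. (f * g) mod M)"
  proof (intro equalityI subsetI)
    fix p assume p: "p \<in> code_poly ` E"
    hence "degree p < n" using lin(1) degree_code_poly[OF n] by blast
    hence pm: "p mod M = p" unfolding M_def by (rule mod_xn_1_small)
    hence "p \<in> I" using p by (simp add: I_def)
    then obtain f where "p = f * g" using g(1) by (auto simp: dvd_def mult.commute)
    hence "p = (f * g) mod M" using pm by simp
    thus "p \<in> range (\<lambda>f. (f * g) mod M)" by blast
  next
    fix p assume "p \<in> range (\<lambda>f. (f * g) mod M)"
    then obtain f where f: "p = (f * g) mod M" by auto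
    have "f * g \<in> I" using g(1) by simp
    thus "p \<in> code_poly ` E" by (simp add: f I_def)
  qed
  thus ?thesis using that g(2) gM unfolding generates_code_def M_def by blast
qed

lemma generator_poly_generates:
  "0 < n \<Longrightarrow> cyclic_code n E \<Longrightarrow> generates_code n E (generator_poly n E)"
  unfolding generator_poly_def
  by (rule theI') (metis cyclic_code_ex_generator generates_code_unique)

lemma generates_code_multiple:
  assumes "generates_code n E (g :: 'a::field poly)" "g dvd f"
  obtains c where "c \<in> E" "code_poly c = f mod (monom 1 n - 1)"
proof -
  obtain u where "f = u * g" using assms(2) by (metis dvd_def mult.commute)
  hence "f mod (monom 1 n - 1) \<in> code_poly ` E" using assms(1) unfolding generates_code_def by blast
  thus ?thesis using that by (metis imageE)
qed

section \<open>Duals of cyclic codes\<close>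

lemma dual_code_mem_iff:
  fixes E :: "'a::field vec set"
  assumes n: "0 < n" and g: "generates_code n E g" and E: "E \<subseteq> carrier_vec n"
    and v: "v \<in> carrier_vec n"
  shows "v \<in> dual_code n E \<longleftrightarrow> monom 1 n - 1 dvd code_poly (rev_vec v) * g"
proof
  assume v': "v \<in> dual_code n E"
  show "monom 1 n - 1 dvd code_poly (rev_vec v) * g"
  proof (rule xn_1_dvd_if_coeffs[OF n])
    fix k
    \<comment> \<open>The remainders of x^k g are codewords; orthogonality to these alone makes the
      coefficient at n - 1 vanish for every shift, and nondegeneracy of the pairing does the
      rest.\<close>
    obtain c where c: "c \<in> E" "code_poly c = (monom 1 k * g) mod (monom 1 n - 1)"
      by (rule generates_code_multiple[OF g dvd_triv_right])
    have "v \<bullet> c = coeff ((code_poly (rev_vec v) * code_poly c) mod (monom 1 n - 1)) (n - 1)"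
      using scalar_prod_code_poly[OF n v] c(1) E by auto
    also have "(code_poly (rev_vec v) * code_poly c) mod (monom 1 n - 1) =
        (monom 1 k * (code_poly (rev_vec v) * g)) mod (monom 1 n - 1)"
      unfolding c(2) mod_mult_right_eq by (simp add: mult_ac)
    finally show "coeff ((monom 1 k * (code_poly (rev_vec v) * g)) mod (monom 1 n - 1)) (n - 1) = 0"
      using v' c(1) by (simp add: dual_code_def)
  qed
next
  assume d: "monom 1 n - 1 dvd code_poly (rev_vec v) * g"
  have "v \<bullet> c = 0" if c: "c \<in> E" for c
  proof -
    have cc: "c \<in> carrier_vec n" using c E by auto
    have "code_poly (rev_vec v) * g dvd code_poly (rev_vec v) * code_poly c"
      using generates_code_mem_iff[OF n g E cc] c by simp
    with d have "monom 1 n - 1 dvd code_poly (rev_vec v) * code_poly c" by (rule dvd_trans)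
    thus ?thesis using scalar_prod_code_poly[OF n v cc] by (simp add: mod_eq_0_iff_dvd[THEN iffD2])
  qed
  thus "v \<in> dual_code n E" using v by (simp add: dual_code_def)
qed

lemma cyclic_code_dual:
  fixes E :: "'a::field vec set"
  assumes n: "0 < n" and E: "cyclic_code n E"
  shows "cyclic_code n (dual_code n E)"
proof -
  have sub: "E \<subseteq> carrier_vec n" using E by (simp add: cyclic_code_def linear_code_iff)
  obtain g where g: "generates_code n E g" using cyclic_code_ex_generator[OF n E] .
  have "linear_code n (dual_code n E)"
    using sub unfolding linear_code_iff dual_code_def
    by (auto simp: add_scalar_prod_distrib[of _ n] smult_scalar_prod_distrib[of _ n] subset_iff)
  moreover have "cyclic_shift n v \<in> dual_code n E" if v: "v \<in> dual_code n E" for v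
  proof -
    have vc: "v \<in> carrier_vec n" using v by (simp add: dual_code_def)
    let ?s = "rev_vec (cyclic_shift n v)"
    have sc: "?s \<in> carrier_vec n" by (intro rev_vec_carrier cyclic_shift_carrier)
    \<comment> \<open>Multiplying the reversal of the shifted word by x gives the reversal of
      \<open>v\<close> modulo x^n - 1. Divisibility therefore holds after multiplication by x, and x
      can be cancelled.\<close>
    have "monom 1 1 * (code_poly ?s * g)
        = code_poly (rev_vec v) * g + Polynomial.smult (?s $ (n - 1)) (monom 1 n - 1) * g"
      unfolding mult.assoc[symmetric] code_poly_shift[OF n sc] rev_vec_cyclic_shift[OF n vc]
      by (simp add: distrib_right)
    moreover have "monom 1 n - 1 dvd Polynomial.smult (?s $ (n - 1)) (monom 1 n - 1) * g"
      by (intro dvd_mult2 dvd_smult) simp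
    ultimately have "monom 1 n - 1 dvd monom 1 1 * (code_poly ?s * g)"
      using v dual_code_mem_iff[OF n g sub vc] by (metis dvd_add)
    hence "monom 1 n - 1 dvd code_poly ?s * g" by (rule xn_1_dvd_cancel_x[OF n])
    thus ?thesis using dual_code_mem_iff[OF n g sub cyclic_shift_carrier] by blast
  qed
  ultimately show ?thesis by (simp add: cyclic_code_def)
qed

text \<open>With x^n - 1 = g h, reversing the remainders of x^k h gives dual words. Orthogonality of
  \<open>c\<close> to all of them forces g h to divide h times the polynomial of \<open>c\<close>,
  and cancelling h shows that \<open>c\<close> is in the code.\<close>

lemma cyclic_code_double_dual:
  fixes E :: "'a::field vec set"
  assumes n: "0 < n" and E: "cyclic_code n E"
  shows "dual_code n (dual_code n E) = E"
proof (intro equalityI subsetI)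
  have sub: "E \<subseteq> carrier_vec n" using E by (simp add: cyclic_code_def linear_code_iff)
  obtain g where g: "generates_code n E g" using cyclic_code_ex_generator[OF n E] .
  fix c
  {
    assume "c \<in> E"
    thus "c \<in> dual_code n (dual_code n E)"
      using sub by (auto simp: dual_code_def comm_scalar_prod[of _ n] subset_iff)
  }
  assume c: "c \<in> dual_code n (dual_code n E)"
  have cc: "c \<in> carrier_vec n" using c by (simp add: dual_code_def)
  obtain h where h: "monom 1 n - 1 = g * h" using g unfolding generates_code_def by blast
  have "monom 1 n - 1 dvd h * code_poly c"
  proof (rule xn_1_dvd_if_coeffs[OF n])
    fix k
    define p where "p = (monom 1 k * h) mod (monom 1 n - 1)"
    have "p \<in> polys_below n" unfolding p_def polys_below_iff[OF n] by (rule degree_mod_xn_1[OF n])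
    then obtain w where w: "w \<in> carrier_vec n" "code_poly w = p"
      by (metis code_poly_image_carrier imageE)
    define v where "v = rev_vec w"
    have v: "v \<in> carrier_vec n" "code_poly (rev_vec v) = p"
      using w by (auto simp: v_def rev_vec_carrier rev_vec_rev_vec)
    have "(p * g) mod (monom 1 n - 1) = (monom 1 k * (g * h)) mod (monom 1 n - 1)"
      unfolding p_def mod_mult_left_eq by (simp add: mult_ac)
    also have "\<dots> = 0" by (simp add: h)
    finally have "v \<in> dual_code n E"
      using dual_code_mem_iff[OF n g sub v(1)] v(2) by (simp add: mod_eq_0_iff_dvd)
    hence "0 = v \<bullet> c" using c v(1) cc by (simp add: dual_code_def comm_scalar_prod[of v n])
    also have "\<dots> = coeff ((p * code_poly c) mod (monom 1 n - 1)) (n - 1)"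
      using scalar_prod_code_poly[OF n v(1) cc] v(2) by simp
    also have "(p * code_poly c) mod (monom 1 n - 1) =
        (monom 1 k * (h * code_poly c)) mod (monom 1 n - 1)"
      unfolding p_def mod_mult_left_eq by (simp add: mult_ac)
    finally show "coeff ((monom 1 k * (h * code_poly c)) mod (monom 1 n - 1)) (n - 1) = 0" by simp
  qed
  moreover have "h \<noteq> 0" using h xn_1_nonzero[OF n, where ?'a='a] by auto
  ultimately have "g dvd code_poly c" unfolding h by (simp add: mult.commute[of g])
  thus "c \<in> E" using generates_code_mem_iff[OF n g sub cc] by simp
qed

lemma code_dim_Int:
  fixes C D :: "'a::{field,finite} vec set"
  assumes n: "0 < n" and C: "cyclic_code n C" and D: "cyclic_code n D"
    and gC: "generates_code n (dual_code n C) g\<^sub>1" and gD: "generates_code n (dual_code n D) g\<^sub>2"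
    and G: "G = u * g\<^sub>1 + v * g\<^sub>2" "G dvd g\<^sub>1" "G dvd g\<^sub>2"
  shows "code_dim n (C \<inter> D) = degree G"
proof -
  have mem: "c \<in> E \<longleftrightarrow> monom 1 n - 1 dvd code_poly (rev_vec c) * g"
    if "cyclic_code n E" "generates_code n (dual_code n E) g" "c \<in> carrier_vec n" for E c and g :: "'a poly"
    using dual_code_mem_iff[OF n that(2) _ that(3)] cyclic_code_double_dual[OF n that(1)]
    by (auto simp: dual_code_def)
  have "G dvd monom 1 n - 1" using G(2) gC dvd_trans unfolding generates_code_def by blast
  \<comment> \<open>\<open>L\<close> is the cofactor of \<open>G\<close> in x^n - 1. Cancelling
    \<open>G\<close> turns membership in the intersection into divisibility of the reversed word by
    \<open>L\<close>.\<close>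
  then obtain L where L: "monom 1 n - 1 = L * G" by (metis dvd_def mult.commute)
  have nz: "L \<noteq> 0" "G \<noteq> 0" using L xn_1_nonzero[OF n, where ?'a='a] by auto
  have deg: "n = degree L + degree G"
    using nz degree_xn_1[OF n, where ?'a='a] by (simp add: L degree_mult_eq)
  have sub: "C \<subseteq> carrier_vec n" "D \<subseteq> carrier_vec n"
    using C D by (auto simp: cyclic_code_def linear_code_iff)
  have mem_Int: "c \<in> C \<inter> D \<longleftrightarrow> L dvd code_poly (rev_vec c)" if c: "c \<in> carrier_vec n" for c
  proof -
    have "c \<in> C \<inter> D \<longleftrightarrow> monom 1 n - 1 dvd code_poly (rev_vec c) * g\<^sub>1 \<and>
        monom 1 n - 1 dvd code_poly (rev_vec c) * g\<^sub>2"
      using mem[OF C gC c] mem[OF D gD c] by simp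
    \<comment> \<open>One direction uses the Bezout identity for \<open>G\<close>, the other that
      \<open>G\<close> divides both generators.\<close>
    also have "\<dots> \<longleftrightarrow> monom 1 n - 1 dvd code_poly (rev_vec c) * G"
    proof
      assume "monom 1 n - 1 dvd code_poly (rev_vec c) * g\<^sub>1 \<and>
          monom 1 n - 1 dvd code_poly (rev_vec c) * g\<^sub>2"
      moreover have "code_poly (rev_vec c) * G =
          u * (code_poly (rev_vec c) * g\<^sub>1) + v * (code_poly (rev_vec c) * g\<^sub>2)"
        by (simp add: G(1) algebra_simps)
      ultimately show "monom 1 n - 1 dvd code_poly (rev_vec c) * G" by simp
    qed (use G(2,3) in \<open>meson dvd_refl dvd_trans mult_dvd_mono\<close>)
    also have "\<dots> \<longleftrightarrow> L dvd code_poly (rev_vec c)" using nz by (simp add: L)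
    finally show ?thesis .
  qed
  have bij: "bij_betw (\<lambda>c. code_poly (rev_vec c)) (carrier_vec n) (polys_below n :: 'a poly set)"
  proof -
    have "bij_betw code_poly (carrier_vec n) (polys_below n :: 'a poly set)"
      by (simp add: bij_betw_def code_poly_inj code_poly_image_carrier)
    from bij_betw_trans[OF bij_betw_rev_vec this] show ?thesis by (simp add: comp_def)
  qed
  have "C \<inter> D = {c \<in> carrier_vec n. L dvd code_poly (rev_vec c)}"
    using mem_Int sub by auto
  moreover have "bij_betw (\<lambda>c. code_poly (rev_vec c)) {c \<in> carrier_vec n. L dvd code_poly (rev_vec c)}
      {p \<in> polys_below n. L dvd p}"
    using bij unfolding bij_betw_def by (auto simp: inj_on_def)
  ultimately have "bij_betw (\<lambda>c. code_poly (rev_vec c)) (C \<inter> D) {p \<in> polys_below n. L dvd p}" by simp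
  hence "card (C \<inter> D) = card {p \<in> polys_below n. L dvd p}" by (rule bij_betw_same_card)
  also have "\<dots> = CARD('a) ^ degree G"
    unfolding deg using card_multiples_polys_below[OF nz(1)] by simp
  finally have card: "card (C \<inter> D) = CARD('a) ^ degree G" .
  \<comment> \<open>Infinite sets have cardinality 0, so a positive cardinality yields
    finiteness.\<close>
  hence "finite (C \<inter> D)" by (intro card_ge_0_finite) simp
  with C D have "card (C \<inter> D) = CARD('a) ^ code_dim n (C \<inter> D)"
    by (intro card_eq_power_code_dim linear_code_Int) (auto simp: cyclic_code_def)
  moreover have "1 < CARD('a)"
  proof -
    have "card {0, 1 :: 'a} \<le> CARD('a)" by (intro card_mono) auto
    thus ?thesis by simp
  qed
  ultimately show ?thesis using card by (simp add: power_inject_exp)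
qed

section \<open>Roots of unity and cyclotomic cosets\<close>

lemma finite_field_power_card:
  fixes a :: "'a::{field,finite}"
  shows "a ^ CARD('a) = a"
proof (cases "a = 0")
  case False
  \<comment> \<open>Multiplication by \<open>a\<close> permutes the nonzero elements; comparing
    their products gives a^(q-1) = 1.\<close>
  have "(\<Prod>y\<in>UNIV - {0}. y) = (\<Prod>y\<in>UNIV - {0}. a * y)"
    by (rule prod.reindex_bij_witness[of _ "\<lambda>y. a * y" "\<lambda>y. y / a"]) (use False in auto)
  also have "\<dots> = a ^ (CARD('a) - 1) * (\<Prod>y\<in>UNIV - {0}. y)"
    by (simp add: prod.distrib card_Diff_singleton)
  finally have "a ^ (CARD('a) - 1) = 1" by simp
  hence "a ^ Suc (CARD('a) - 1) = a" by (simp only: power_Suc mult_1_right)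
  moreover have "Suc (CARD('a) - 1) = CARD('a)" using finite_UNIV_card_ge_0[where ?'a = 'a] by simp
  ultimately show ?thesis by metis
qed (simp add: finite_UNIV_card_ge_0)

text \<open>The polynomial \<open>(x + 1)\<^sup>q - x\<^sup>q - 1\<close> has degree below \<open>q\<close> and vanishes on the whole field, so
  it is zero; this avoids knowing that \<open>q\<close> is a prime power.\<close>

lemma of_nat_binomial_card_eq_0:
  assumes "0 < k" "k < CARD('a)"
  shows "of_nat (CARD('a) choose k) = (0 :: 'a::{field,finite})"
proof -
  let ?q = "CARD('a)"
  define P :: "'a poly" where "P = [:1, 1:] ^ ?q"
  define R :: "'a poly" where "R = monom 1 ?q + 1"
  have q: "0 < ?q" by (simp add: finite_UNIV_card_ge_0)
  have dP: "degree P = ?q" unfolding P_def by (simp add: degree_linear_power)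
  have P: "coeff P j = of_nat (?q choose j)" if "j \<le> ?q" for j
    unfolding P_def using that by (subst coeff_linear_poly_power) auto
  have "P = R"
  proof (rule poly_eqI_degree_lead_coeff[where A = UNIV and n = ?q])
    show "coeff P ?q = coeff R ?q" using q by (simp add: P R_def)
    show "degree P \<le> ?q" by (simp add: dP)
    show "degree R \<le> ?q" unfolding R_def
      by (intro degree_add_le) (auto simp: degree_monom_eq)
    fix z :: 'a
    show "poly P z = poly R z"
      by (simp add: P_def R_def poly_monom finite_field_power_card add.commute)
  qed simp
  hence "coeff P k = coeff R k" by simp
  thus ?thesis using assms by (simp add: P R_def)
qed

context
  fixes h :: "'a::{field,finite} \<Rightarrow> 'b::field"
  assumes hom: "field_hom h"
begin

interpretation field_hom h by (fact hom)
interpretation hp: map_poly_inj_idom_hom h ..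

lemma frobenius_add: "(x + y :: 'b) ^ CARD('a) = x ^ CARD('a) + y ^ CARD('a)"
proof -
  let ?q = "CARD('a)"
  have q: "0 < ?q" by (simp add: finite_UNIV_card_ge_0)
  \<comment> \<open>The inner binomial coefficients vanish in the base field, and \<open>h\<close>
    carries this to the extension.\<close>
  have z: "of_nat (?q choose k) = (0 :: 'b)" if "k \<in> {1..<?q}" for k
  proof -
    have "of_nat (?q choose k) = (0 :: 'a)" using that by (intro of_nat_binomial_card_eq_0) auto
    hence "h (of_nat (?q choose k)) = 0" by simp
    thus ?thesis by (simp only: hom_of_nat)
  qed
  have "{..?q} = insert 0 (insert ?q {1..<?q})" using q by auto
  hence "(x + y) ^ ?q = (\<Sum>k\<in>insert 0 (insert ?q {1..<?q}). of_nat (?q choose k) * x ^ k * y ^ (?q - k))"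
    by (simp add: binomial_ring)
  also have "\<dots> = y ^ ?q + (x ^ ?q + (\<Sum>k\<in>{1..<?q}. of_nat (?q choose k) * x ^ k * y ^ (?q - k)))"
    using q by simp
  also have "(\<Sum>k\<in>{1..<?q}. of_nat (?q choose k) * x ^ k * y ^ (?q - k)) = 0"
    by (rule sum.neutral) (simp add: z)
  finally show ?thesis by simp
qed

text \<open>Coefficients coming from the base field are fixed by the q-th power, which is additive
  and multiplicative. Hence the roots of such a polynomial are closed under x -> x^q.\<close>

lemma poly_frobenius: "poly (map_poly h p) (x ^ CARD('a)) = poly (map_poly h p) x ^ CARD('a)"
proof (induction p)
  case 0
  show ?case using finite_UNIV_card_ge_0[where ?'a='a] by simp
next
  case (pCons a p)
  have "h a ^ CARD('a) = h a" by (simp add: hom_power[symmetric] finite_field_power_card)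
  thus ?case by (simp add: hom_distribs frobenius_add power_mult_distrib pCons.IH)
qed

end

section \<open>Cyclotomic cosets as equivalence classes\<close>

lemma ex_power_mod_eq_1:
  assumes "0 < n" "coprime n (q::nat)"
  obtains k where "0 < k" "q ^ k mod n = 1 mod n"
proof -
  \<comment> \<open>Pigeonhole: n + 1 exponents share n residues, and coprimality cancels the
    smaller of two equal powers.\<close>
  have "\<not> inj_on (\<lambda>k. q ^ k mod n) {..n}"
  proof
    assume "inj_on (\<lambda>k. q ^ k mod n) {..n}"
    moreover have "(\<lambda>k. q ^ k mod n) ` {..n} \<subseteq> {..<n}" using assms(1) by auto
    ultimately have "card {..n} \<le> card {..<n}" by (meson card_inj_on_le finite_lessThan)
    thus False by simp
  qed
  then obtain i j where ij: "i < j" "q ^ i mod n = q ^ j mod n"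
    unfolding inj_on_def by (metis linorder_neqE_nat)
  have "[q ^ i * 1 = q ^ i * q ^ (j - i)] (mod n)"
    using ij by (simp add: cong_def flip: power_add)
  moreover have "coprime (q ^ i) n" using assms(2) by (simp add: coprime_commute)
  ultimately have "[1 = q ^ (j - i)] (mod n)" by (metis cong_mult_lcancel_nat)
  thus ?thesis using ij(1) by (intro that[of "j - i"]) (auto simp: cong_def)
qed

context
  fixes n q :: nat
  assumes n: "0 < n" and cop: "coprime n q"
begin

text \<open>Multiplication by q^d fixes a modulo n, where d is the coset size, so every exponent can
  be reduced modulo d. Free exponents make the equivalence relation easy to handle.\<close>

lemma cyclotomic_coset_iff: "x \<in> cyclotomic_coset q n a \<longleftrightarrow> (\<exists>k. x = (a * int q ^ k) mod int n)"
proof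
  assume "\<exists>k. x = (a * int q ^ k) mod int n"
  then obtain k where k: "x = (a * int q ^ k) mod int n" ..
  define d where "d = coset_size q n a"
  \<comment> \<open>A witness is needed for the \<open>LEAST\<close> in \<open>coset_size\<close> to
    be a genuine minimum.\<close>
  have "\<exists>d. 0 < d \<and> (a * int q ^ d) mod int n = a mod int n"
  proof -
    obtain m where m: "0 < m" "q ^ m mod n = 1 mod n" using ex_power_mod_eq_1[OF n cop] .
    have "int q ^ m mod int n = 1 mod int n" using m(2) by (metis of_nat_1 of_nat_mod of_nat_power)
    hence "(a * int q ^ m) mod int n = (a * 1) mod int n" by (metis mod_mult_right_eq)
    with m(1) show ?thesis by auto
  qed
  from LeastI_ex[OF this] have d: "0 < d" "(a * int q ^ d) mod int n = a mod int n"
    unfolding d_def coset_size_def by auto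
  have step: "(a * int q ^ (r + m * d)) mod int n = (a * int q ^ r) mod int n" for r m
  proof (induction m)
    case (Suc m)
    have "(a * int q ^ (r + Suc m * d)) mod int n = (a * int q ^ d * int q ^ (r + m * d)) mod int n"
      by (simp add: power_add mult_ac)
    also have "\<dots> = (a * int q ^ (r + m * d)) mod int n" using d(2) by (metis mod_mult_left_eq)
    finally show ?case using Suc.IH by simp
  qed simp
  have "x = (a * int q ^ (k mod d)) mod int n"
    unfolding k using step[of "k mod d" "k div d"] by (simp add: mod_mult_div_eq mult.commute)
  thus "x \<in> cyclotomic_coset q n a"
    unfolding cyclotomic_coset_def d_def[symmetric] using d(1) by auto
qed (auto simp: cyclotomic_coset_def)

lemma cyclotomic_coset_range: "cyclotomic_coset q n a \<subseteq> {0..<int n}"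
  using n by (auto simp: cyclotomic_coset_def)

lemma cyclotomic_coset_self: "a mod int n \<in> cyclotomic_coset q n a"
  unfolding cyclotomic_coset_iff by (rule exI[of _ 0]) simp

lemma cyclotomic_coset_trans:
  assumes "x \<in> cyclotomic_coset q n a" "y \<in> cyclotomic_coset q n x"
  shows "y \<in> cyclotomic_coset q n a"
proof -
  obtain k m where x: "x = (a * int q ^ k) mod int n" and y: "y = (x * int q ^ m) mod int n"
    using assms unfolding cyclotomic_coset_iff by blast
  have "y = (a * int q ^ (k + m)) mod int n"
    unfolding y x mod_mult_left_eq by (simp add: power_add mult_ac)
  thus ?thesis unfolding cyclotomic_coset_iff by blast
qed

lemma cyclotomic_coset_sym:
  assumes "x \<in> cyclotomic_coset q n a"
  shows "a mod int n \<in> cyclotomic_coset q n x"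
proof -
  obtain k where x: "x = (a * int q ^ k) mod int n" using assms unfolding cyclotomic_coset_iff by blast
  obtain m where m: "0 < m" "q ^ m mod n = 1 mod n" using ex_power_mod_eq_1[OF n cop] .
  have 1: "int q ^ (k * m) mod int n = 1 mod int n"
  proof -
    have "[q ^ m = 1] (mod n)" using m(2) by (simp add: cong_def)
    hence "[(q ^ m) ^ k = 1 ^ k] (mod n)" by (rule cong_pow)
    hence "q ^ (k * m) mod n = 1 mod n" by (simp add: cong_def power_mult[symmetric] mult.commute)
    thus ?thesis by (metis of_nat_1 of_nat_mod of_nat_power)
  qed
  \<comment> \<open>With q^m = 1 modulo n, the factor q^(k(m-1)) inverts q^k.\<close>
  have "(x * int q ^ (k * (m - 1))) mod int n = (a * (int q ^ k * int q ^ (k * (m - 1)))) mod int n"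
    unfolding x mod_mult_left_eq by (simp add: mult_ac)
  also have "int q ^ k * int q ^ (k * (m - 1)) = int q ^ (k * m)"
    using m(1) by (cases m) (simp_all add: power_add)
  also have "(a * int q ^ (k * m)) mod int n = (a * 1) mod int n" using 1 by (metis mod_mult_right_eq)
  finally show ?thesis unfolding cyclotomic_coset_iff by (metis mult_1_right)
qed

context
  fixes t :: nat and i :: "nat \<Rightarrow> int"
  assumes leaders: "coset_leaders q n t i"
begin

lemma coset_leader_unique:
  assumes "j \<in> {1..t}" "j' \<in> {1..t}" "i j mod int n \<in> cyclotomic_coset q n (i j')"
  shows "j = j'"
  using leaders assms cyclotomic_coset_self[of "i j'"] unfolding coset_leaders_def by blast

text \<open>The definition places a leader in the coset of \<open>s\<close>; symmetry places
  \<open>s\<close> in the coset of that leader. Reduction modulo \<open>n\<close> appears because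
  leaders are arbitrary integers.\<close>

lemma coset_leader_mem:
  obtains j where "j \<in> {1..t}" "s mod int n \<in> cyclotomic_coset q n (i j)"
proof -
  obtain j where j: "j \<in> {1..t}" "i j mod int n \<in> cyclotomic_coset q n s"
    using leaders unfolding coset_leaders_def by blast
  have "s mod int n \<in> cyclotomic_coset q n (i j mod int n)" by (rule cyclotomic_coset_sym[OF j(2)])
  hence "s mod int n \<in> cyclotomic_coset q n (i j)"
    by (rule cyclotomic_coset_trans[OF cyclotomic_coset_self])
  with j(1) that show ?thesis by blast
qed

lemma cyclotomic_cosets_disjoint:
  assumes "j \<in> {1..t}" "j' \<in> {1..t}" "s \<in> cyclotomic_coset q n (i j)" "s \<in> cyclotomic_coset q n (i j')"
  shows "j = j'"
  using coset_leader_unique[OF assms(1,2)] cyclotomic_coset_trans[OF assms(4) cyclotomic_coset_sym[OF assms(3)]]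
  by blast

end

section \<open>Powers of the primitive root\<close>

context
  fixes \<alpha> :: "'b::field"
  assumes prim: "primitive_root_of_unity n \<alpha>"
begin

lemma root_of_unity_nonzero: "\<alpha> \<noteq> 0"
  using prim n by (auto simp: primitive_root_of_unity_def zero_power)

lemma root_of_unity_powi_mod: "\<alpha> powi (a mod int n) = \<alpha> powi a"
proof -
  have "\<alpha> powi a = \<alpha> powi (int n * (a div int n) + a mod int n)" by simp
  also have "\<dots> = (\<alpha> powi int n) powi (a div int n) * \<alpha> powi (a mod int n)"
    using root_of_unity_nonzero by (subst power_int_add) (simp_all only: power_int_mult simp_thms)
  also have "\<alpha> powi int n = 1" using prim by (simp add: primitive_root_of_unity_def)
  finally show ?thesis by simp
qed

lemma root_of_unity_powi_eq_1: "\<alpha> powi a = 1 \<longleftrightarrow> a mod int n = 0"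
proof
  assume "\<alpha> powi a = 1"
  hence "\<alpha> ^ nat (a mod int n) = 1"
    using n root_of_unity_powi_mod[of a] by (simp add: power_int_def)
  moreover have "nat (a mod int n) < n" using n by (simp add: nat_less_iff)
  ultimately have "\<not> 0 < nat (a mod int n)" using prim by (auto simp: primitive_root_of_unity_def)
  moreover have "0 \<le> a mod int n" using n by simp
  ultimately show "a mod int n = 0" by linarith
next
  assume "a mod int n = 0"
  thus "\<alpha> powi a = 1" using root_of_unity_powi_mod[of a] by simp
qed

lemma root_of_unity_powi_eq_iff: "\<alpha> powi a = \<alpha> powi b \<longleftrightarrow> a mod int n = b mod int n"
proof -
  have "\<alpha> powi a = \<alpha> powi b \<longleftrightarrow> \<alpha> powi (a - b) = 1"
    using root_of_unity_nonzero by (simp add: power_int_diff)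
  also have "\<dots> \<longleftrightarrow> a mod int n = b mod int n"
    unfolding root_of_unity_powi_eq_1 by (simp only: mod_eq_dvd_iff mod_eq_0_iff_dvd)
  finally show ?thesis .
qed

lemma inj_on_root_of_unity_powi: "inj_on (\<lambda>s. \<alpha> powi s) {0..<int n}"
  by (auto simp: inj_on_def root_of_unity_powi_eq_iff)

text \<open>Both sides are monic of degree n and vanish at the n distinct powers of
  \<alpha>.\<close>

lemma xn_1_eq_prod_roots: "monom 1 n - 1 = (\<Prod>x\<in>(\<lambda>s. \<alpha> powi s) ` {0..<int n}. [:- x, 1:])"
proof (rule poly_eqI_degree_lead_coeff[where n = n and A = "(\<lambda>s. \<alpha> powi s) ` {0..<int n}"])
  have d: "degree (\<Prod>x\<in>(\<lambda>s. \<alpha> powi s) ` {0..<int n}. [:- x, 1:]) = n"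
    using card_image[OF inj_on_root_of_unity_powi] by (subst degree_prod_eq_sum_degree) simp_all
  show "degree (\<Prod>x\<in>(\<lambda>s. \<alpha> powi s) ` {0..<int n}. [:- x, 1:]) \<le> n" using d by simp
  show "coeff (monom 1 n - 1) n = coeff (\<Prod>x\<in>(\<lambda>s. \<alpha> powi s) ` {0..<int n}. [:- x, 1:]) n"
    using lead_coeff_prod_linear[of "(\<lambda>s. \<alpha> powi s) ` {0..<int n}"] lead_coeff_xn_1[OF n, where ?'a='b]
    by (simp only: d degree_xn_1[OF n])
  show "degree (monom 1 n - 1 :: 'b poly) \<le> n" by (simp only: degree_xn_1[OF n])
  show "n \<le> card ((\<lambda>s. \<alpha> powi s) ` {0..<int n})"
    using card_image[OF inj_on_root_of_unity_powi] by simp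
next
  fix z assume z: "z \<in> (\<lambda>s. \<alpha> powi s) ` {0..<int n}"
  then obtain s where s: "z = \<alpha> powi s" by blast
  have "z ^ n = (\<alpha> powi int n) powi s"
    unfolding s by (simp add: power_int_power' power_int_power mult.commute)
  also have "\<dots> = 1" using prim by (simp add: primitive_root_of_unity_def)
  finally have "poly (monom 1 n - 1) z = 0" by (simp add: poly_monom)
  moreover have "poly (\<Prod>x\<in>(\<lambda>s. \<alpha> powi s) ` {0..<int n}. [:- x, 1:]) z = 0"
    using z by (auto simp: poly_prod)
  ultimately show "poly (monom 1 n - 1) z = poly (\<Prod>x\<in>(\<lambda>s. \<alpha> powi s) ` {0..<int n}. [:- x, 1:]) z"
    by simp
qed

lemma coset_min_poly_eq:
  "coset_min_poly q n \<alpha> a = (\<Prod>x\<in>(\<lambda>s. \<alpha> powi s) ` cyclotomic_coset q n a. [:- x, 1:])"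
  unfolding coset_min_poly_def
  using inj_on_subset[OF inj_on_root_of_unity_powi cyclotomic_coset_range]
  by (simp add: prod.reindex)

lemma degree_coset_min_poly: "degree (coset_min_poly q n \<alpha> a) = card (cyclotomic_coset q n a)"
  unfolding coset_min_poly_def by (subst degree_prod_eq_sum_degree) auto

lemma poly_coset_min_poly_eq_0_iff:
  "poly (coset_min_poly q n \<alpha> a) (\<alpha> powi b) = 0 \<longleftrightarrow> b mod int n \<in> cyclotomic_coset q n a"
proof -
  have "finite (cyclotomic_coset q n a)" by (simp add: cyclotomic_coset_def)
  moreover have "s mod int n = s" if "s \<in> cyclotomic_coset q n a" for s
    using cyclotomic_coset_range that by force
  ultimately show ?thesis
    unfolding coset_min_poly_def by (auto simp: poly_prod root_of_unity_powi_eq_iff)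
qed

end

end

section \<open>Factoring divisors of x^n - 1 over the extension field\<close>

definition root_leaders ::
  "('a::field \<Rightarrow> 'b::field) \<Rightarrow> 'b \<Rightarrow> nat \<Rightarrow> (nat \<Rightarrow> int) \<Rightarrow> 'a poly \<Rightarrow> nat set" where
  "root_leaders h \<alpha> t i g = {j \<in> {1..t}. poly (map_poly h g) (\<alpha> powi i j) = 0}"

context
  fixes h :: "'a::{field,finite} \<Rightarrow> 'b::field" and n t :: nat and \<alpha> :: 'b and i :: "nat \<Rightarrow> int"
  assumes hom: "field_hom h" and n: "0 < n" and cop: "coprime n CARD('a)"
    and prim: "primitive_root_of_unity n \<alpha>" and leaders: "coset_leaders CARD('a) n t i"
begin

interpretation field_hom h by (fact hom)
interpretation hp: map_poly_inj_idom_hom h ..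

text \<open>Applying Frobenius k times takes the root \<alpha>^a to the root \<alpha>^(a
  q^k).\<close>

lemma poly_root_coset:
  assumes "s \<in> cyclotomic_coset CARD('a) n a" "poly (map_poly h g) (\<alpha> powi a) = 0"
  shows "poly (map_poly h g) (\<alpha> powi s) = 0"
proof -
  obtain k where s: "s = (a * int CARD('a) ^ k) mod int n"
    using assms(1) cyclotomic_coset_iff[OF n cop] by blast
  have "poly (map_poly h g) (\<alpha> powi (a * int CARD('a) ^ k)) = 0"
  proof (induction k)
    case (Suc k)
    have "\<alpha> powi (a * int CARD('a) ^ Suc k) = (\<alpha> powi (a * int CARD('a) ^ k)) powi int CARD('a)"
      unfolding power_int_mult[symmetric] by (simp add: mult_ac)
    hence "\<alpha> powi (a * int CARD('a) ^ Suc k) = (\<alpha> powi (a * int CARD('a) ^ k)) ^ CARD('a)"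
      by (simp only: power_int_of_nat)
    thus ?case using Suc.IH finite_UNIV_card_ge_0[where ?'a='a]
      by (simp only: poly_frobenius[OF hom]) simp
  qed (simp add: assms(2))
  thus ?thesis unfolding s root_of_unity_powi_mod[OF n cop prim] .
qed

text \<open>The polynomial is the product of x - z over its roots z among the powers of \<alpha>.
  These roots fill whole cosets, and the cosets of different leaders are disjoint, so the product
  splits into minimal polynomials.\<close>

lemma monic_dvd_xn_1_eq_prod_coset_min_poly:
  assumes g: "lead_coeff g = 1" "g dvd monom 1 n - 1"
  shows "map_poly h g = (\<Prod>j\<in>root_leaders h \<alpha> t i g. coset_min_poly CARD('a) n \<alpha> (i j))"
proof -
  let ?R = "\<lambda>j. (\<lambda>s. \<alpha> powi s) ` cyclotomic_coset CARD('a) n (i j)"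
  let ?A = "(\<lambda>s. \<alpha> powi s) ` {0..<int n}"
  obtain u where "monom 1 n - 1 = g * u" using g(2) ..
  hence "map_poly h (monom 1 n - 1) = map_poly h g * map_poly h u" by (simp add: hom_distribs)
  hence "map_poly h g * map_poly h u = (\<Prod>x\<in>?A. [:- x, 1:])"
    by (simp add: hom_distribs xn_1_eq_prod_roots[OF n cop prim])
  hence "map_poly h g = (\<Prod>x\<in>{x \<in> ?A. poly (map_poly h g) x = 0}. [:- x, 1:])"
    by (rule monic_dvd_prod_linear[rotated]) (simp_all add: g(1))
  also have "{x \<in> ?A. poly (map_poly h g) x = 0} = (\<Union>j\<in>root_leaders h \<alpha> t i g. ?R j)"
  proof (intro equalityI subsetI)
    fix x assume "x \<in> {x \<in> ?A. poly (map_poly h g) x = 0}"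
    then obtain s where s: "0 \<le> s" "s < int n" "x = \<alpha> powi s" "poly (map_poly h g) (\<alpha> powi s) = 0"
      by auto
    obtain j where j: "j \<in> {1..t}" "s mod int n \<in> cyclotomic_coset CARD('a) n (i j)"
      using coset_leader_mem[OF n cop leaders] .
    have "poly (map_poly h g) (\<alpha> powi (i j mod int n)) = 0"
      by (rule poly_root_coset[OF cyclotomic_coset_sym[OF n cop j(2)]]) (use s in simp)
    hence "j \<in> root_leaders h \<alpha> t i g"
      using j(1) by (simp add: root_leaders_def root_of_unity_powi_mod[OF n cop prim])
    moreover have "x \<in> ?R j" using j(2) s by auto
    ultimately show "x \<in> (\<Union>j\<in>root_leaders h \<alpha> t i g. ?R j)" by blast
  next
    fix x assume "x \<in> (\<Union>j\<in>root_leaders h \<alpha> t i g. ?R j)"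
    then obtain j s where "j \<in> root_leaders h \<alpha> t i g" "s \<in> cyclotomic_coset CARD('a) n (i j)"
      "x = \<alpha> powi s" by blast
    moreover from this have "poly (map_poly h g) (\<alpha> powi s) = 0"
      by (intro poly_root_coset[of s "i j"]) (auto simp: root_leaders_def)
    ultimately show "x \<in> {x \<in> ?A. poly (map_poly h g) x = 0}"
      using cyclotomic_coset_range[OF n cop] by blast
  qed
  also have "(\<Prod>x\<in>(\<Union>j\<in>root_leaders h \<alpha> t i g. ?R j). [:- x, 1:])
      = (\<Prod>j\<in>root_leaders h \<alpha> t i g. \<Prod>x\<in>?R j. [:- x, 1:])"
  proof (rule prod.UNION_disjoint)
    show "finite (root_leaders h \<alpha> t i g)" by (simp add: root_leaders_def)
    show "\<forall>j\<in>root_leaders h \<alpha> t i g. finite (?R j)" by (simp add: cyclotomic_coset_def)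
    show "\<forall>j\<in>root_leaders h \<alpha> t i g. \<forall>j'\<in>root_leaders h \<alpha> t i g. j \<noteq> j' \<longrightarrow> ?R j \<inter> ?R j' = {}"
    proof (intro ballI impI)
      fix j j' assume j: "j \<in> root_leaders h \<alpha> t i g" "j' \<in> root_leaders h \<alpha> t i g" "j \<noteq> j'"
      have "cyclotomic_coset CARD('a) n (i j) \<inter> cyclotomic_coset CARD('a) n (i j') = {}"
        using cyclotomic_cosets_disjoint[OF n cop leaders, of j j'] j by (auto simp: root_leaders_def)
      \<comment> \<open>Disjointness passes from exponents to powers because s -> \<alpha>^s is
        injective on the residues.\<close>
      thus "?R j \<inter> ?R j' = {}"
        using inj_on_image_Int[OF inj_on_root_of_unity_powi[OF n cop prim]
            cyclotomic_coset_range[OF n cop] cyclotomic_coset_range[OF n cop]] by (metis image_empty)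
    qed
  qed
  finally show ?thesis by (simp only: coset_min_poly_eq[OF n cop prim])
qed

lemma degree_eq_sum_card_cosets:
  assumes g: "lead_coeff g = 1" "g dvd monom 1 n - 1"
  shows "degree g = (\<Sum>j\<in>root_leaders h \<alpha> t i g. card (cyclotomic_coset CARD('a) n (i j)))"
proof -
  have nz: "coset_min_poly CARD('a) n \<alpha> a \<noteq> 0" for a
    by (auto simp: coset_min_poly_def cyclotomic_coset_def)
  have "degree g = degree (map_poly h g)" by simp
  also have "\<dots> = (\<Sum>j\<in>root_leaders h \<alpha> t i g. card (cyclotomic_coset CARD('a) n (i j)))"
    unfolding monic_dvd_xn_1_eq_prod_coset_min_poly[OF g]
    by (subst degree_prod_eq_sum_degree) (simp_all add: nz degree_coset_min_poly[OF n cop prim])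
  finally show ?thesis .
qed

text \<open>The factorization supplies an index set for the \<open>THE\<close> in \<open>BZ\<close>,
  and any such set is recovered from the polynomial as the leaders at which it vanishes.\<close>

lemma BZ_eq:
  assumes E: "cyclic_code n E"
  shows "BZ h n \<alpha> t i E = (\<lambda>j. \<alpha> powi i j) ` root_leaders h \<alpha> t i (generator_poly n E)"
proof -
  let ?g = "generator_poly n E"
  have g: "lead_coeff ?g = 1" "?g dvd monom 1 n - 1"
    using generator_poly_generates[OF n E] by (auto simp: generates_code_def)
  have "(THE S. S \<subseteq> {1..t} \<and> map_poly h ?g = (\<Prod>j\<in>S. coset_min_poly CARD('a) n \<alpha> (i j)))
      = root_leaders h \<alpha> t i ?g"
  proof (rule the_equality)
    show "root_leaders h \<alpha> t i ?g \<subseteq> {1..t} \<and>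
        map_poly h ?g = (\<Prod>j\<in>root_leaders h \<alpha> t i ?g. coset_min_poly CARD('a) n \<alpha> (i j))"
      using monic_dvd_xn_1_eq_prod_coset_min_poly[OF g] by (auto simp: root_leaders_def)
  next
    fix S assume S: "S \<subseteq> {1..t} \<and> map_poly h ?g = (\<Prod>j\<in>S. coset_min_poly CARD('a) n \<alpha> (i j))"
    hence fin: "finite S" using finite_subset by blast
    have "poly (map_poly h ?g) (\<alpha> powi i j) = 0 \<longleftrightarrow> j \<in> S" if j: "j \<in> {1..t}" for j
    proof -
      have "poly (map_poly h ?g) (\<alpha> powi i j) = 0 \<longleftrightarrow>
          (\<exists>j'\<in>S. i j mod int n \<in> cyclotomic_coset CARD('a) n (i j'))"
        using S fin by (simp add: poly_prod poly_coset_min_poly_eq_0_iff[OF n cop prim])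
      \<comment> \<open>A leader lies in no coset of another leader, so among the factors only the
        one indexed by \<open>j\<close> can vanish there.\<close>
      also have "\<dots> \<longleftrightarrow> j \<in> S"
        using coset_leader_unique[OF n cop leaders j] cyclotomic_coset_self[OF n cop] S by blast
      finally show ?thesis .
    qed
    thus "S = root_leaders h \<alpha> t i ?g" using S by (auto simp: root_leaders_def)
  qed
  thus ?thesis unfolding BZ_def by simp
qed

end

theorem theorem7:
  fixes h :: "'a::{field,finite} \<Rightarrow> 'b::field"
    and q n t :: nat
    and \<alpha> :: 'b
    and i :: "nat \<Rightarrow> int"
    and C D :: "'a vec set"
    and T\<^sub>1 :: "'b set"
  assumes "q = CARD('a)"
    and "field_hom h"
    and "0 < n"
    and "gcd n q = 1"
    and "primitive_root_of_unity n \<alpha>"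
    and "coset_leaders q n t i"
    and "cyclic_code n C"
    and "cyclic_code n D"
    and "T\<^sub>1 = BZ h n \<alpha> t i (dual_code n C) \<inter> BZ h n \<alpha> t i (dual_code n D)"
  shows "code_dim n (C \<inter> D) =
    (\<Sum>j\<in>{j \<in> {1..t}. \<alpha> powi i j \<in> T\<^sub>1}. card (cyclotomic_coset q n (i j)))"
proof -
  interpret field_hom h by (fact assms(2))
  interpret hp: map_poly_inj_idom_hom h ..
  have cop: "coprime n CARD('a)" using assms(1,4) by (simp add: coprime_iff_gcd_eq_1)
  note ctx = assms(2,3) cop assms(5) assms(6)[unfolded assms(1)]
  define g\<^sub>1 where "g\<^sub>1 = generator_poly n (dual_code n C)"
  define g\<^sub>2 where "g\<^sub>2 = generator_poly n (dual_code n D)"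
  have dC: "cyclic_code n (dual_code n C)" and dD: "cyclic_code n (dual_code n D)"
    using cyclic_code_dual assms(3,7,8) by blast+
  have g1: "generates_code n (dual_code n C) g\<^sub>1" and g2: "generates_code n (dual_code n D) g\<^sub>2"
    unfolding g\<^sub>1_def g\<^sub>2_def by (rule generator_poly_generates[OF assms(3)], fact)+
  have "g\<^sub>1 \<noteq> 0" using g1 by (auto simp: generates_code_def)
  then obtain G u v where G: "lead_coeff G = 1" "G = u * g\<^sub>1 + v * g\<^sub>2" "G dvd g\<^sub>1" "G dvd g\<^sub>2"
    by (rule monic_poly_bezout)
  have GM: "G dvd monom 1 n - 1" using G(3) g1 dvd_trans unfolding generates_code_def by blast
  \<comment> \<open>Common roots of both generators are roots of \<open>G\<close> by the Bezout
    identity; the converse holds because \<open>G\<close> divides both.\<close>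
  have roots: "poly (map_poly h G) x = 0 \<longleftrightarrow> poly (map_poly h g\<^sub>1) x = 0 \<and> poly (map_poly h g\<^sub>2) x = 0" for x
  proof -
    obtain a b where ab: "g\<^sub>1 = G * a" "g\<^sub>2 = G * b" using G(3,4) by (auto elim!: dvdE)
    have "poly (map_poly h G) x =
        poly (map_poly h u) x * poly (map_poly h g\<^sub>1) x + poly (map_poly h v) x * poly (map_poly h g\<^sub>2) x"
      by (subst G(2)) (simp add: hom_distribs)
    moreover have "poly (map_poly h g\<^sub>1) x = poly (map_poly h G) x * poly (map_poly h a) x"
      "poly (map_poly h g\<^sub>2) x = poly (map_poly h G) x * poly (map_poly h b) x"
      by (simp_all add: ab hom_distribs)
    ultimately show ?thesis by auto
  qed
  \<comment> \<open>Vanishing depends only on the value \<alpha>^(i_j), so nothing is lost when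
    \<open>BZ\<close> records powers of \<alpha> instead of indices.\<close>
  have mem: "\<alpha> powi i j \<in> (\<lambda>j. \<alpha> powi i j) ` root_leaders h \<alpha> t i g \<longleftrightarrow>
      poly (map_poly h g) (\<alpha> powi i j) = 0" if "j \<in> {1..t}" for j g
    using that by (auto simp: root_leaders_def)
  have "code_dim n (C \<inter> D) = degree G" by (rule code_dim_Int[OF assms(3,7,8) g1 g2 G(2-4)])
  also have "\<dots> = (\<Sum>j\<in>root_leaders h \<alpha> t i G. card (cyclotomic_coset CARD('a) n (i j)))"
    by (rule degree_eq_sum_card_cosets[OF ctx G(1) GM])
  also have "root_leaders h \<alpha> t i G = {j \<in> {1..t}. \<alpha> powi i j \<in> T\<^sub>1}"
    unfolding assms(9) BZ_eq[OF ctx dC] BZ_eq[OF ctx dD] g\<^sub>1_def[symmetric] g\<^sub>2_def[symmetric]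
    using mem roots by (auto simp: root_leaders_def[of h \<alpha> t i G])
  finally show ?thesis by (simp add: assms(1))
qed

end
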